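(* Let $\Omega=\{\omega_1,\dots,\omega_k\}\subseteq\mathbb{Z}^n$ be totally unimodular. Then the unary facet complexity $\operatorname{ufc}(\operatorname{conv}\Omega)$ is at most $n$. As a consequence, the facet gap $\varphi$ of $\Omega$ satisfies $$\varphi\ge n^{-3/2}.$$ Furthermore, if $\theta\in\mathbb{Q}^n$ lies in the relative interior of $\operatorname{conv}\Omega$, then $$r_\theta\ge2^{-\langle\theta\rangle}\,n^{-3/2}.$$ If $\theta=0$, the latter lower bound can be improved to $n^{-3/2}$.
   Context: $\Omega=\{\omega_1,\dots,\omega_k\}\subseteq\mathbb{Z}^n$ is totally unimodular if the $n\times k$ matrix with columns $\omega_1,\dots,\omega_k$ is totally unimodular, i.e. every square submatrix has determinant $0$, $1$ or $-1$. $\Omega$ is assumed to contain at least two points so that the following quantities are well-defined. $\operatorname{aff}$ denotes affine hull. - For an integral polytope $P\subseteq\mathbb{R}^n$, $\operatorname{ufc}(P)$ is the smallest integer $M\ge0$ such that $P$ is the intersection of $\operatorname{aff}P$ with half-spaces $\{p:\langle p,a\rangle\le b\}$ with $a\in\mathbb{Z}^n$, $b\in\mathbb{R}$, $\|a\|_\infty\le M$. - The facet gap $\varphi>0$ of $\Omega$ is the smallest Euclidean distance $d(\omega,\operatorname{aff}\mathcal F)$ over all facets $\mathcal F$ of $\operatorname{conv}\Omega$ and all $\omega\in\Omega\setminus \mathcal F$ (facets are faces of codimension one relative to $\operatorname{aff}\Omega$). - $r_\theta=\max\{r\ge 0: B(\theta,r)\cap\operatorname{aff}\Omega\subseteq\operatorname{conv}\Omega\}$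 is the Euclidean distance from $\theta$ to the relative boundary of $\operatorname{conv}\Omega$. - $\langle\theta\rangle$ is the binary encoding length in the convention of Grötschel–Lovász–Schrijver: $\langle m\rangle=1+\lceil\log_2(|m|+1)\rceil$ for an integer $m$; $\langle p/s\rangle=\langle p\rangle+\langle s\rangle$ for coprime integers $p,s$ with $s>0$; $\langle v\rangle=n+\sum_{j=1}^n\langle v_j\rangle$ for $v\in\mathbb{Q}^n$. *)

theory Defs
  imports "Jordan_Normal_Form.Determinant" "HOL-Analysis.Analysis"
begin

no_notation Matrix.vec_index (infixl "$" 100)
no_notation Matrix.scalar_prod (infix "\<bullet>" 70)

text \<open>
  The determinants need a dimension that is not a type, hence the determinant of
  \<open>Jordan_Normal_Form\<close>. A square submatrix is given by injective enumerations \<open>r\<close> and \<open>c\<close> of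
  its rows and columns. Their order only affects the sign of the determinant.
\<close>

definition totally_unimodular :: "'a::comm_ring_1 ^ 'k ^ 'n \<Rightarrow> bool" where
  "totally_unimodular A \<longleftrightarrow>
     (\<forall>m (r :: nat \<Rightarrow> 'n) (c :: nat \<Rightarrow> 'k). inj_on r {..<m} \<and> inj_on c {..<m} \<longrightarrow>
        Determinant.det (Matrix.mat m m (\<lambda>(i, j). A $ r i $ c j)) \<in> {0, 1, -1})"

definition int_lattice :: "(real ^ 'n) set" where
  "int_lattice = {v. \<forall>i. v $ i \<in> \<int>}"

text \<open>
  Unary facet complexity. The family \<open>H\<close> of half-spaces may be infinite, but only finitely many
  normals \<open>a\<close> occur in it.
\<close>

definition ufc :: "(real ^ 'n) set \<Rightarrow> nat" where
  "ufc P = (LEAST M. \<exists>H :: ((real ^ 'n) \<times> real) set.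
     (\<forall>(a, b) \<in> H. a \<in> int_lattice \<and> infnorm a \<le> real M) \<and>
     P = affine hull P \<inter> (\<Inter>(a, b) \<in> H. {p. p \<bullet> a \<le> b}))"

definition facet_gap :: "(real ^ 'n) set \<Rightarrow> real" where
  "facet_gap \<Omega> = Min {infdist w (affine hull F) | w F.
     F facet_of (convex hull \<Omega>) \<and> w \<in> \<Omega> - F}"

definition rel_radius :: "(real ^ 'n) set \<Rightarrow> real ^ 'n \<Rightarrow> real" where
  "rel_radius \<Omega> \<theta> =
     (GREATEST r. 0 \<le> r \<and> cball \<theta> r \<inter> affine hull \<Omega> \<subseteq> convex hull \<Omega>)"

text \<open>
  Binary encoding length in the convention of Groetschel, Lovasz and Schrijver. The function
  \<open>quotient_of\<close> yields the coprime representation with positive denominator.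
\<close>

definition enc_int :: "int \<Rightarrow> int" where
  "enc_int m = 1 + \<lceil>log 2 (real_of_int (\<bar>m\<bar> + 1))\<rceil>"

definition enc_rat :: "rat \<Rightarrow> int" where
  "enc_rat q = enc_int (fst (quotient_of q)) + enc_int (snd (quotient_of q))"

definition enc_vec :: "rat ^ 'n \<Rightarrow> int" where
  "enc_vec v = int CARD('n) + (\<Sum>j\<in>UNIV. enc_rat (v $ j))"

definition real_vec :: "rat ^ 'n \<Rightarrow> real ^ 'n" where
  "real_vec v = (\<chi> i. of_rat (v $ i))"

end

theory Submission
  imports Defs
begin

text \<open>
  Every facet \<open>F\<close> of the polytope is cut out by a system \<open>\<langle>a, v\<rangle> = f v\<close> with \<open>f v \<in> {0, 1}\<close> over linearly
  independent points \<open>v\<close> of \<open>\<Omega>\<close>. By Cramer's rule and Laplace expansion, total unimodularity yields an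
  integral solution \<open>a\<close> whose entries are sums of at most \<open>n\<close> signs. Hence the facet inequality reads
  \<open>\<langle>a, x\<rangle> \<le> b\<close> with integral \<open>a\<close>, \<open>b\<close> and Euclidean norm \<open>\<parallel>a\<parallel> \<le> n powr (3/2)\<close>. The slack \<open>b - \<langle>a, p\<rangle>\<close>
  of a point off the facet is at least \<open>1\<close> for integral \<open>p\<close>, and at least the reciprocal of the product
  of the denominators of the coordinates for rational \<open>p\<close>. Dividing by \<open>\<parallel>a\<parallel>\<close> bounds the distance.
\<close>

section \<open>Minors of a totally unimodular matrix and Cramer's rule\<close>

text \<open>In the systems below the equations belong to points (columns of \<open>A\<close>) and
  the unknowns to coordinates (rows of \<open>A\<close>), so the coefficient matrix is a transposed
  submatrix.\<close>

lemma totally_unimodular_det_transposed: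
  fixes A :: "'a::comm_ring_1 ^ 'k ^ 'n"
  assumes "totally_unimodular A" and "inj_on r {..<m}" and "inj_on c {..<m}"
  shows "Determinant.det (Matrix.mat m m (\<lambda>(i, j). A $ r j $ c i)) \<in> {0, 1, -1}"
proof -
  let ?M = "Matrix.mat m m (\<lambda>(i, j). A $ r i $ c j)"
  have "Matrix.mat m m (\<lambda>(i, j). A $ r j $ c i) = transpose_mat ?M"
    by (auto simp: transpose_mat_def)
  moreover have "Determinant.det (transpose_mat ?M) = Determinant.det ?M"
    by (rule Determinant.det_transpose[of _ m]) simp
  ultimately show ?thesis
    using assms unfolding totally_unimodular_def by auto
qed

lemma totally_unimodular_cofactor:
  fixes A :: "'a::comm_ring_1 ^ 'k ^ 'n"
  assumes tu: "totally_unimodular A" and r: "inj_on r {..<m}" and c: "inj_on c {..<m}"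
    and i: "i < m" and j: "j < m"
    and M: "M = Matrix.mat m m (\<lambda>(i, j). A $ r j $ c i)"
  shows "Determinant.cofactor M i j \<in> {0, 1, -1}"
proof -
  \<comment> \<open>Enumerations skipping one position. Because of the transposition, deleting row
    \<open>i\<close> of \<open>M\<close> drops the column \<open>c i\<close> of
    \<open>A\<close>.\<close>
  let ?r = "\<lambda>k. r (if k < j then k else Suc k)" and ?c = "\<lambda>k. c (if k < i then k else Suc k)"
  have skip: "inj_on (\<lambda>k. g (if k < l then k else Suc k)) {..<m - 1}"
    if "inj_on g {..<m}" "l < m" for l and g :: "nat \<Rightarrow> 'b"
  proof (rule inj_onI)
    fix x y
    assume "x \<in> {..<m - 1}" "y \<in> {..<m - 1}"
      "g (if x < l then x else Suc x) = g (if y < l then y else Suc y)"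
    then have "(if x < l then x else Suc x) = (if y < l then y else Suc y)"
      by (intro inj_onD[OF that(1)]) auto
    then show "x = y"
      by (auto split: if_splits)
  qed
  have "mat_delete M i j = Matrix.mat (m - 1) (m - 1) (\<lambda>(i, j). A $ ?r j $ ?c i)"
    using i j by (intro eq_matI) (auto simp: mat_delete_def M)
  moreover have "inj_on ?r {..<m - 1}" "inj_on ?c {..<m - 1}"
    using skip r c i j by blast+
  ultimately have "Determinant.det (mat_delete M i j) \<in> {0, 1, -1}"
    using totally_unimodular_det_transposed[OF tu, of ?r "m - 1" ?c] by (simp only:)
  then show ?thesis
    unfolding Determinant.cofactor_def by (cases "even (i + j)") auto
qed

text \<open>By \<open>nonsing\<close> the determinant is \<plusminus>1, so Cramer's rule gives
  \<open>y k\<close> up to sign as the determinant with column \<open>k\<close> replaced by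
  \<open>f\<close>. Its expansion along this column is a sum of \<open>m\<close> terms, each 0 or
  \<plusminus>1.\<close>

lemma totally_unimodular_solution:
  fixes A :: "real ^ 'k ^ 'n"
  assumes tu: "totally_unimodular A" and r: "inj_on r {..<m}" and c: "inj_on c {..<m}"
    and sol: "\<And>i. i < m \<Longrightarrow> (\<Sum>j<m. A $ r j $ c i * y j) = f i"
    and f: "\<And>i. i < m \<Longrightarrow> f i \<in> {0, 1}"
    and nonsing: "\<And>z. (\<And>i. i < m \<Longrightarrow> (\<Sum>j<m. A $ r j $ c i * z j) = 0) \<Longrightarrow> \<forall>j<m. z j = 0"
    and k: "k < m"
  shows "y k \<in> \<int>" and "\<bar>y k\<bar> \<le> real m"
proof -
  define M where "M = Matrix.mat m m (\<lambda>(i, j). A $ r j $ c i)"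
  define x where "x = Matrix.vec m y"
  have M: "M \<in> carrier_mat m m" and x: "x \<in> carrier_vec m" 
    by (auto simp: M_def x_def)
  have mult: "vec_index (M *\<^sub>v Matrix.vec m z) i = (\<Sum>j<m. A $ r j $ c i * z j)" if "i < m" for z i
    using that by (simp add: M_def Matrix.scalar_prod_def atLeast0LessThan)
  have "Determinant.det M \<noteq> 0"
  proof
    assume "Determinant.det M = 0"
    then obtain v where v: "v \<in> carrier_vec m" "v \<noteq> 0\<^sub>v m" "M *\<^sub>v v = 0\<^sub>v m"
      using det_0_iff_vec_prod_zero[OF M] by blast
    have v': "v = Matrix.vec m (vec_index v)"
      using v(1) by auto
    have "(\<Sum>j<m. A $ r j $ c i * vec_index v j) = 0" if "i < m" for i
      using mult[OF that, of "vec_index v"] v(3) that v' by simp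
    then have "\<forall>j<m. vec_index v j = 0"
      by (rule nonsing)
    then show False
      using v(1,2) by auto
  qed
  then have det: "Determinant.det M \<in> {1, -1}"
    using totally_unimodular_det_transposed[OF tu r c] unfolding M_def by blast
  \<comment> \<open>\<open>M *\<^sub>v x\<close> is the right-hand side \<open>f\<close>, in the
    shape used by \<open>cramer_lemma_mat\<close>.\<close>
  define N where "N = replace_col M (M *\<^sub>v x) k"
  have N: "N \<in> carrier_mat m m" 
    using M by (auto simp: N_def replace_col_def)
  have entry: "N $$ (i, k) = f i" if "i < m" for i
    using that k M mult[OF that, of y] sol[OF that] by (simp add: N_def replace_col_def x_def)
  \<comment> \<open>Deleting column \<open>k\<close> removes the only column in which
    \<open>N\<close> and \<open>M\<close> differ.\<close>
  have "mat_delete N i k = mat_delete M i k" if "i < m" for i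
    using that k M by (intro eq_matI) (auto simp: N_def replace_col_def mat_delete_def)
  then have cof: "Determinant.cofactor N i k \<in> {0, 1, -1}" if "i < m" for i
    using that totally_unimodular_cofactor[OF tu r c that k M_def]
    by (simp add: Determinant.cofactor_def)
  have "y k * Determinant.det M = Determinant.det N"
    using cramer_lemma_mat[OF M x k] k by (simp add: N_def x_def)
  also have "\<dots> = (\<Sum>i<m. f i * Determinant.cofactor N i k)"
    using laplace_expansion_column[OF N k] entry by simp
  finally have yk: "y k = (\<Sum>i<m. f i * Determinant.cofactor N i k) \<or>
      y k = - (\<Sum>i<m. f i * Determinant.cofactor N i k)" (is "y k = ?s \<or> _")
    using det by auto
  have "?s \<in> \<int>"
    using f cof by (intro Ints_sum Ints_mult) fastforce+
  with yk show "y k \<in> \<int>"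
    by auto
  have "\<bar>?s\<bar> \<le> (\<Sum>i<m. \<bar>f i * Determinant.cofactor N i k\<bar>)"
    by (rule sum_abs)
  also have "\<dots> \<le> (\<Sum>i<m. 1)"
    using f cof by (intro sum_mono) fastforce
  finally show "\<bar>y k\<bar> \<le> real m"
    using yk by auto
qed

text \<open>Independence alone makes the prescribed values attainable; integrality and the bound
  come from a solution supported on \<open>card B\<close> coordinates, which solves a square
  system.\<close>

lemma totally_unimodular_dual_vector:
  fixes \<omega> :: "'k::finite \<Rightarrow> real ^ 'n"
  assumes tu: "totally_unimodular (\<chi> i j. \<omega> j $ i)"
    and B: "B \<subseteq> range \<omega>" "independent B"
    and f: "\<And>v. v \<in> B \<Longrightarrow> f v \<in> {0, 1}"
  obtains a where "a \<in> int_lattice" "infnorm a \<le> real CARD('n)" "\<And>v. v \<in> B \<Longrightarrow> a \<bullet> v = f v"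
proof -
  \<comment> \<open>Completing \<open>B\<close> to a basis by axis vectors and letting \<open>a\<close> vanish on those selects a nonsingular
    square submatrix, with rows \<open>J\<close>, of the matrix with columns \<open>B\<close>.\<close>
  obtain D where D: "B \<subseteq> D" "D \<subseteq> B \<union> Basis" "independent D" "B \<union> Basis \<subseteq> span D"
    using maximal_independent_subset_extend[of B "B \<union> Basis"] B(2) by auto
  have spanD: "span D = UNIV"
    using D(4) by (metis le_sup_iff span_Basis span_mono span_span top.extremum_uniqueI)
  have finD: "finite D" and finB: "finite B"
    using D(3) B(2) independent_imp_finite by auto
  define J where "J = {i. axis i 1 \<notin> D - B}"
  have DB: "D - B = (\<lambda>i. axis i 1) ` (- J)"
  proof
    show "D - B \<subseteq> (\<lambda>i. axis i 1) ` (- J)"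
      using D(2) by (force simp: J_def Basis_vec_def)
  qed (auto simp: J_def)
  have cardD: "card D = CARD('n)"
    using basis_card_eq_dim[of D UNIV] D(3) spanD by simp
  \<comment> \<open>Since \<open>D\<close> has as many elements as there are coordinates, this makes
    the submatrix square.\<close>
  have "card (D - B) = card (- J)"
    unfolding DB by (rule card_image) (auto simp: inj_on_def axis_eq_axis)
  then have cardJ: "card J = card B"
    using cardD D(1) finB finD card_Diff_subset[of B D] card_mono[of D B] card_mono[of UNIV J]
    by (simp add: Compl_eq_Diff_UNIV card_Diff_subset)
  define m where "m = card B"
  obtain b where b: "bij_betw b {..<m} B"
    using ex_bij_betw_nat_finite[OF finB] by (auto simp: m_def atLeast0LessThan)
  obtain r where r: "bij_betw r {..<m} J"
    using ex_bij_betw_nat_finite[of J] cardJ by (auto simp: m_def atLeast0LessThan)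
  \<comment> \<open>One column index is chosen per point: \<omega> may repeat points, but distinct
    points get distinct indices.\<close>
  define c where "c i = inv_into UNIV \<omega> (b i)" for i
  have c: "\<omega> (c i) = b i" if "i < m" for i
  proof -
    have "b i \<in> B"
      using b that by (simp add: bij_betwE)
    then show ?thesis
      unfolding c_def using B(1) by (intro f_inv_into_f) blast
  qed
  have injc: "inj_on c {..<m}"
    using b c by (metis (no_types, lifting) bij_betw_imp_inj_on inj_on_def lessThan_iff)
  have injr: "inj_on r {..<m}"
    using r bij_betw_imp_inj_on by blast
  have supported: "z \<bullet> v = (\<Sum>j<m. v $ r j * z $ r j)" if "\<And>i. i \<notin> J \<Longrightarrow> z $ i = 0" for z v
  proof -
    have "z \<bullet> v = (\<Sum>i\<in>J. v $ i * z $ i)"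
      unfolding inner_vec_def by (rule sum.mono_neutral_cong_right) (auto simp: that)
    also have "\<dots> = (\<Sum>j<m. v $ r j * z $ r j)"
      by (rule sum.reindex_bij_betw[OF r, symmetric])
    finally show ?thesis .
  qed
  obtain g where g: "linear g" "\<And>v. v \<in> D \<Longrightarrow> g v = (if v \<in> B then f v else 0)"
    using linear_independent_extend[OF D(3), of "\<lambda>v. if v \<in> B then f v else 0"] by auto
  \<comment> \<open>The vector representing the functional \<open>g\<close>.\<close>
  define a where "a = adjoint g 1"
  have ga: "a \<bullet> v = g v" for v
    using adjoint_works[OF g(1), of v 1] by (simp add: a_def inner_commute)
  have aJ: "a $ i = 0" if "i \<notin> J" for i
  proof -
    have "axis i 1 \<in> D - B"
      using that by (simp add: J_def)
    then show ?thesis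
      using g(2)[of "axis i 1"] ga[of "axis i 1"] by (simp add: inner_axis)
  qed
  have av: "a \<bullet> v = f v" if "v \<in> B" for v
    using g(2)[of v] ga that D(1) by auto
  have sol: "(\<Sum>j<m. (\<chi> i j. \<omega> j $ i) $ r j $ c i * a $ r j) = f (b i)" if "i < m" for i
    using supported[OF aJ, of "b i"] av[of "b i"] that c b by (simp add: bij_betwE)
  have nonsing: "\<forall>j<m. z j = 0"
    if z: "\<And>i. i < m \<Longrightarrow> (\<Sum>j<m. (\<chi> i j. \<omega> j $ i) $ r j $ c i * z j) = 0" for z :: "nat \<Rightarrow> real"
  proof -
    \<comment> \<open>A kernel vector, extended by zero off \<open>J\<close>, is orthogonal to
      \<open>B\<close> by the equations and to the added axis vectors by its support. Since
      \<open>D\<close> spans, it is orthogonal to itself.\<close>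
    define u :: "real ^ 'n" where
      "u = (\<chi> i. if i \<in> J then z (inv_into {..<m} r i) else 0)"
    have ur: "u $ r j = z j" if "j < m" for j
      using that r injr by (auto simp: u_def bij_betwE)
    have uJ: "u $ i = 0" if "i \<notin> J" for i
      using that by (simp add: u_def)
    have "u \<bullet> v = 0" if "v \<in> D" for v
    proof (cases "v \<in> B")
      case True
      then obtain i where i: "i < m" "v = b i"
        using b by (metis bij_betw_imp_surj_on imageE lessThan_iff)
      show ?thesis
        using supported[OF uJ, of "b i"] z[OF i(1)] i c by (simp add: ur)
    next
      case False
      then have "v \<in> (\<lambda>i. axis i 1) ` (- J)"
        using that DB[symmetric] by simp
      then obtain i where "i \<notin> J" "v = axis i 1"
        by blast
      then show ?thesis
        by (simp add: inner_axis uJ)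
    qed
    then have "u \<bullet> u = 0"
      using orthogonal_to_span[of u D u] spanD by (simp add: orthogonal_def)
    then show ?thesis
      using ur by simp
  qed
  have bound: "a $ i \<in> \<int> \<and> \<bar>a $ i\<bar> \<le> real m" for i
  proof (cases "i \<in> J")
    case True
    then obtain k where "k < m" "i = r k"
      using r by (metis bij_betw_imp_surj_on imageE lessThan_iff)
    moreover have "f (b i) \<in> {0, 1}" if "i < m" for i
      using f that b by (simp add: bij_betwE)
    ultimately show ?thesis
      using totally_unimodular_solution[OF tu injr injc sol _ nonsing, of k] by blast
  qed (simp add: aJ)
  have "real m \<le> real CARD('n)"
    using card_mono[OF finD D(1)] cardD by (simp add: m_def)
  then have "\<bar>a $ i\<bar> \<le> real CARD('n)" for i
    using bound order_trans by blast
  then have "infnorm a \<le> real CARD('n)"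
    unfolding infnorm_cart by (intro cSup_least) auto
  then show thesis
    using that[of a] bound av by (auto simp: int_lattice_def)
qed

section \<open>Facets and their integral inequalities\<close>

text \<open>As \<open>x0\<close> lies off the hyperplane, the section of
  \<open>affine hull P\<close> has the dimension of \<open>F\<close> and hence equals
  \<open>affine hull F\<close>. If \<open>P\<close> had points strictly on both sides, a segment
  between them would meet \<open>F\<close> in its interior, and the face property would force its
  endpoints into \<open>F\<close>.\<close>

lemma
  fixes P :: "'a::euclidean_space set"
  assumes P: "convex P" and F: "F facet_of P" and Fab: "F \<subseteq> {x. a \<bullet> x = b}"
    and x0: "x0 \<in> affine hull P" "a \<bullet> x0 \<noteq> b"
  shows facet_Int_hyperplane: "P \<inter> {x. a \<bullet> x = b} = F"
    and facet_one_sided: "P \<subseteq> {x. a \<bullet> x \<le> b} \<or> P \<subseteq> {x. a \<bullet> x \<ge> b}"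
proof -
  have face: "F face_of P" and "F \<noteq> {}" and dimF: "aff_dim F = aff_dim P - 1"
    using F by (auto simp: facet_of_def)
  have "affine hull F \<subseteq> affine hull P \<inter> {x. a \<bullet> x = b}"
    using Fab face_of_imp_subset[OF face]
    by (simp add: affine_hyperplane hull_minimal hull_mono)
  moreover from this \<open>F \<noteq> {}\<close> have "aff_dim (affine hull P \<inter> {x. a \<bullet> x = b}) = aff_dim F"
    using x0 dimF aff_dim_affine_Int_hyperplane[of "affine hull P" a b] hull_subset[of F affine]
    by auto
  ultimately have "affine hull F = affine hull P \<inter> {x. a \<bullet> x = b}"
    using \<open>F \<noteq> {}\<close>
    by (intro affine_dim_equal) (auto simp: affine_hyperplane affine_Int)
  then show eq: "P \<inter> {x. a \<bullet> x = b} = F"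
    using face_of_imp_eq_affine_Int[OF P face] hull_subset[of P affine] by blast
  show "P \<subseteq> {x. a \<bullet> x \<le> b} \<or> P \<subseteq> {x. a \<bullet> x \<ge> b}"
  proof (rule ccontr)
    assume "\<not> ?thesis"
    then obtain p q where p: "p \<in> P" "a \<bullet> p > b" and q: "q \<in> P" "a \<bullet> q < b"
      by fastforce
    \<comment> \<open>The parameter at which the segment from \<open>p\<close> to \<open>q\<close>
      crosses the hyperplane.\<close>
    define t where "t = (a \<bullet> p - b) / (a \<bullet> p - a \<bullet> q)"
    define y where "y = (1 - t) *\<^sub>R p + t *\<^sub>R q"
    have t: "0 < t" "t < 1"
      using p q by (auto simp: t_def)
    have "t * (a \<bullet> p - a \<bullet> q) = a \<bullet> p - b"
      using p q by (simp add: t_def)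
    then have "a \<bullet> y = b"
      by (simp add: y_def algebra_simps)
    moreover have y: "y \<in> open_segment p q"
      using t p q by (auto simp: y_def in_segment)
    then have "y \<in> P"
      using convex_contains_open_segment P p q by blast
    ultimately have "y \<in> F"
      using eq by blast
    then have "p \<in> F"
      using face_ofD[OF face y] p q by blast
    then show False
      using Fab p by auto
  qed
qed

text \<open>Adjoining the origin keeps \<open>C\<close> affinely independent, and affine
  independence together with the origin is linear independence. This turns affine bases into input
  for \<open>totally_unimodular_dual_vector\<close>.\<close>

lemma independent_if_zero_notin_affine_hull:
  assumes "\<not> affine_dependent C" and "0 \<notin> affine hull C"
  shows "independent (C :: 'a::euclidean_space set)"
proof -
  have "\<not> affine_dependent (insert 0 C)"
    using assms by (rule affine_independent_insert)
  moreover have "0 \<notin> C"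
    using assms(2) hull_inc by metis
  ultimately show ?thesis
    using affine_dependent_iff_dependent[of 0 C] by simp
qed

text \<open>It suffices to find a small integral functional that is constant on \<open>S\<close> but
  not on \<open>affine hull (range \<omega>)\<close>. The position of the origin decides which
  values can be prescribed.\<close>

lemma totally_unimodular_facet:
  fixes \<omega> :: "'k::finite \<Rightarrow> real ^ 'n"
  assumes tu: "totally_unimodular (\<chi> i j. \<omega> j $ i)"
    and F: "F facet_of convex hull (range \<omega>)"
  obtains a b where "a \<in> int_lattice" "infnorm a \<le> real CARD('n)" "b \<in> \<int>"
    "convex hull (range \<omega>) \<subseteq> {x. a \<bullet> x \<le> b}" "convex hull (range \<omega>) \<inter> {x. a \<bullet> x = b} = F"
proof -
  let ?\<Omega> = "range \<omega>" and ?P = "convex hull (range \<omega>)"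
  have face: "F face_of ?P" and dimF: "aff_dim F = aff_dim ?P - 1"
    using F by (auto simp: facet_of_def)
  obtain S where S: "S \<subseteq> ?\<Omega>" "F = convex hull S"
    using face_of_convex_hull_subset[OF finite_imp_compact face] by auto
  have affF: "affine hull F = affine hull S"
    by (simp add: S(2))
  have "\<not> ?P \<subseteq> F"
    using dimF aff_dim_subset[of ?P F] by auto
  then obtain w where w: "w \<in> ?\<Omega>" "w \<notin> F"
    using S hull_minimal[of ?\<Omega> F convex] by auto
  have w': "w \<notin> affine hull S"
    using w face_of_imp_eq_affine_Int[OF _ face] affF hull_inc[of w ?\<Omega> convex] by auto
  obtain C where C: "C \<subseteq> S" "\<not> affine_dependent C" "affine hull S = affine hull C"
    using affine_basis_exists[of S] by blast
  have wC: "w \<notin> affine hull C"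
    using w' C(3) by simp
  \<comment> \<open>The point \<open>x0\<close> witnesses that \<open>\<langle>a, _\<rangle>\<close> is not constant on the affine hull of the polytope: it is \<open>w\<close>
    if \<open>f\<close> is \<open>0\<close> on the facet and \<open>1\<close> at \<open>w\<close>, and the origin if \<open>f\<close> is \<open>1\<close> on the facet.\<close>
  obtain a b x0 where a: "a \<in> int_lattice" "infnorm a \<le> real CARD('n)" and b: "b \<in> \<int>"
    and Sab: "S \<subseteq> {x. a \<bullet> x = b}" and x0: "x0 \<in> affine hull ?\<Omega>" "a \<bullet> x0 \<noteq> b"
  proof -
    consider "0 \<in> affine hull S" | "0 \<notin> affine hull ?\<Omega>" | "0 \<notin> affine hull S" "0 \<in> affine hull ?\<Omega>"
      by blast
    then show thesis
    proof cases
      \<comment> \<open>The affine hull of the facet is a linear subspace, so \<open>w\<close>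
        extends any linear basis of it.\<close>
      case 1
      then have span: "affine hull S = span S"
        by (rule affine_hull_span_0)
      obtain B where B: "B \<subseteq> S" "independent B" "S \<subseteq> span B"
        using maximal_independent_subset[of S] by blast
      have wB: "w \<notin> span B"
        using w' span span_mono[OF B(1)] by blast
      have "insert w B \<subseteq> ?\<Omega>" "independent (insert w B)"
        using B S(1) w wB independent_insertI[of w B] by auto
      then obtain a where a: "a \<in> int_lattice" "infnorm a \<le> real CARD('n)"
        "\<And>v. v \<in> insert w B \<Longrightarrow> a \<bullet> v = (if v = w then 1 else 0)"
        by (rule totally_unimodular_dual_vector[OF tu, where f = "\<lambda>v. if v = w then 1 else 0"]) auto
      have "a \<bullet> v = 0" if "v \<in> B" for v
        using a(3)[of v] that wB span_base[of v B] by auto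
      then have "a \<bullet> v = 0" if "v \<in> S" for v
        using orthogonal_to_span[of v B a] that B(3) by (auto simp: orthogonal_def)
      then show thesis
        using that[of a 0 w] a w hull_inc[of w ?\<Omega> affine] by auto
    next
      \<comment> \<open>\<open>C\<close> and \<open>w\<close> are affinely independent, and linearly
        so because the origin is outside the affine hull of \<Omega>.\<close>
      case 2
      have "insert w C \<subseteq> ?\<Omega>"
        using w C S by blast
      then have "independent (insert w C)"
        using 2 affine_independent_insert[OF C(2) wC] hull_mono[of "insert w C" ?\<Omega> affine]
        by (intro independent_if_zero_notin_affine_hull) auto
      then obtain a where a: "a \<in> int_lattice" "infnorm a \<le> real CARD('n)"
        "\<And>v. v \<in> insert w C \<Longrightarrow> a \<bullet> v = (if v = w then 1 else 0)"
        by (rule totally_unimodular_dual_vector[OF tu \<open>insert w C \<subseteq> ?\<Omega>\<close>,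
              where f = "\<lambda>v. if v = w then 1 else 0"]) auto
      have "C \<subseteq> {x. a \<bullet> x = 0}"
        using a(3) wC hull_inc[of w C affine] by auto
      then have "affine hull S \<subseteq> {x. a \<bullet> x = 0}"
        unfolding C(3) by (intro hull_minimal affine_hyperplane)
      then show thesis
        using that[of a 0 w] a w hull_inc[of w ?\<Omega> affine] hull_subset[of S affine] by auto
    next
      \<comment> \<open>Now \<open>C\<close> and \<open>w\<close> affinely span the origin and are
        linearly dependent, so values are prescribed on \<open>C\<close> only.\<close>
      case 3
      then have "independent C"
        using C by (intro independent_if_zero_notin_affine_hull) auto
      moreover have "C \<subseteq> ?\<Omega>"
        using C(1) S(1) by blast
      ultimately obtain a where a: "a \<in> int_lattice" "infnorm a \<le> real CARD('n)"
        "\<And>v. v \<in> C \<Longrightarrow> a \<bullet> v = 1"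
        by (elim totally_unimodular_dual_vector[OF tu, where f = "\<lambda>v. 1", rotated]) auto
      have "affine hull S \<subseteq> {x. a \<bullet> x = 1}"
        unfolding C(3) using a(3) by (intro hull_minimal affine_hyperplane) auto
      then show thesis
        using that[of a 1 0] a 3 hull_subset[of S affine] by auto
    qed
  qed
  have Fab: "F \<subseteq> {x. a \<bullet> x = b}"
    unfolding S(2) using Sab by (intro hull_minimal convex_hyperplane)
  have x0': "x0 \<in> affine hull ?P"
    using x0 by simp
  note eq = facet_Int_hyperplane[OF convex_convex_hull F Fab x0' x0(2)]
  from facet_one_sided[OF convex_convex_hull F Fab x0' x0(2)] show thesis
  proof
    assume "?P \<subseteq> {x. a \<bullet> x \<le> b}"
    then show thesis
      using that[of a b] a b eq by blast
  next
    assume "?P \<subseteq> {x. a \<bullet> x \<ge> b}"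
    then have "?P \<subseteq> {x. (- a) \<bullet> x \<le> - b}"
      by auto
    moreover have "- a \<in> int_lattice"
      using a by (simp add: int_lattice_def)
    moreover have "{x. (- a) \<bullet> x = - b} = {x. a \<bullet> x = b}"
      by simp
    ultimately show thesis
      using that[of "- a" "- b"] a b eq by (metis Ints_minus infnorm_neg)
  qed
qed

text \<open>The ray from \<open>z\<close> through \<open>x\<close> leaves the polytope in a facet
  before reaching \<open>x\<close>. The facet inequality is strict at \<open>z\<close> and tight at
  the exit point, hence violated at \<open>x\<close>.\<close>

lemma totally_unimodular_separation:
  fixes \<omega> :: "'k::finite \<Rightarrow> real ^ 'n"
  assumes tu: "totally_unimodular (\<chi> i j. \<omega> j $ i)"
    and x: "x \<in> affine hull (range \<omega>)" "x \<notin> convex hull (range \<omega>)"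
    and z: "z \<in> rel_interior (convex hull (range \<omega>))"
  obtains a b where "a \<in> int_lattice" "infnorm a \<le> real CARD('n)" "b \<in> \<int>"
    "convex hull (range \<omega>) \<subseteq> {x. a \<bullet> x \<le> b}" "a \<bullet> z < b" "b < a \<bullet> x"
proof -
  let ?P = "convex hull (range \<omega>)"
  have "compact ?P"
    by (simp add: finite_imp_compact compact_convex_hull)
  have poly: "polyhedron ?P"
    by (simp add: polyhedron_convex_hull)
  have zP: "z \<in> ?P"
    using z rel_interior_subset by blast
  then have "x - z \<noteq> 0"
    using x(2) by auto
  moreover have "z + (x - z) \<in> affine hull ?P"
    using x(1) by simp
  ultimately obtain d where d: "0 < d" "z + d *\<^sub>R (x - z) \<in> rel_frontier ?P"
    "\<And>e. 0 \<le> e \<Longrightarrow> e < d \<Longrightarrow> z + e *\<^sub>R (x - z) \<in> rel_interior ?P"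
    using ray_to_rel_frontier[OF compact_imp_bounded[OF \<open>compact ?P\<close>] z] by metis
  \<comment> \<open>For \<open>d = 1\<close> the point \<open>x\<close> would lie on the relative
    frontier of the closed polytope, for \<open>d > 1\<close> in its relative interior.\<close>
  have "d < 1"
  proof (rule ccontr)
    assume "\<not> d < 1"
    moreover have "d \<noteq> 1"
      using d(2) x(2) closure_closed[OF compact_imp_closed[OF \<open>compact ?P\<close>]]
      by (auto simp: rel_frontier_def)
    ultimately show False
      using d(3)[of 1] x(2) rel_interior_subset[of ?P] by auto
  qed
  obtain F where F: "F facet_of ?P" "z + d *\<^sub>R (x - z) \<in> F"
    using d(2) rel_frontier_of_polyhedron[OF poly] by auto
  obtain a b where a: "a \<in> int_lattice" "infnorm a \<le> real CARD('n)" "b \<in> \<int>"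
    "?P \<subseteq> {x. a \<bullet> x \<le> b}" "?P \<inter> {x. a \<bullet> x = b} = F"
    using totally_unimodular_facet[OF tu F(1)] by blast
  have "F face_of ?P" "F \<noteq> ?P"
    using F(1) by (auto simp: facet_of_def)
  then have "z \<notin> F"
    using z face_of_disjoint_rel_interior by blast
  then have zb: "a \<bullet> z < b"
    using a(4,5) zP by force
  have eq: "b - a \<bullet> z = d * (a \<bullet> x - a \<bullet> z)"
    using F(2) a(5) by (auto simp: algebra_simps)
  then have "0 < a \<bullet> x - a \<bullet> z"
    using zb d(1) by (metis diff_gt_0_iff_gt zero_less_mult_pos)
  then have "b - a \<bullet> z < a \<bullet> x - a \<bullet> z"
    unfolding eq using \<open>d < 1\<close> by simp
  then show thesis
    using that[OF a(1-4) zb] by simp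
qed

section \<open>Integral slack and the facet gap\<close>

lemma norm_le_of_infnorm_le_card:
  fixes a :: "real ^ 'n"
  assumes "infnorm a \<le> real CARD('n)"
  shows "norm a \<le> real CARD('n) powr (3 / 2)"
proof -
  have "norm a \<le> sqrt (real CARD('n)) * infnorm a"
    using norm_le_infnorm[of a] by simp
  also have "\<dots> \<le> real CARD('n) powr (1 / 2) * real CARD('n) powr 1"
    using assms by (simp add: powr_half_sqrt mult_left_mono)
  also have "\<dots> = real CARD('n) powr (3 / 2)"
    by (simp only: powr_add[symmetric]) simp
  finally show ?thesis .
qed

lemma inner_int_lattice: "a \<in> int_lattice \<Longrightarrow> w \<in> int_lattice \<Longrightarrow> a \<bullet> w \<in> \<int>"
  by (auto simp: inner_vec_def int_lattice_def)

lemma Ints_pos_ge_1: "x \<in> \<int> \<Longrightarrow> 0 < x \<Longrightarrow> 1 \<le> (x :: real)"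
  by (auto elim!: Ints_cases)

lemma totally_unimodular_infdist_facet:
  fixes \<omega> :: "'k::finite \<Rightarrow> real ^ 'n"
  assumes tu: "totally_unimodular (\<chi> i j. \<omega> j $ i)"
    and int: "range \<omega> \<subseteq> int_lattice"
    and F: "F facet_of convex hull (range \<omega>)"
    and w: "w \<in> range \<omega> - F"
  shows "real CARD('n) powr (- 3 / 2) \<le> infdist w (affine hull F)"
proof -
  let ?P = "convex hull (range \<omega>)"
  obtain a b where a: "a \<in> int_lattice" "infnorm a \<le> real CARD('n)" "b \<in> \<int>"
    "?P \<subseteq> {x. a \<bullet> x \<le> b}" "?P \<inter> {x. a \<bullet> x = b} = F"
    using totally_unimodular_facet[OF tu F] by blast
  have "w \<in> ?P"
    using w hull_inc[of w "range \<omega>" convex] by blast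
  then have "0 < b - a \<bullet> w"
    using w a(4,5) by force
  then have gap: "1 \<le> b - a \<bullet> w"
    using a(1,3) w int by (intro Ints_pos_ge_1 Ints_diff inner_int_lattice) auto
  \<comment> \<open>Excludes the default value 0 of \<open>infdist\<close> for the empty
    set.\<close>
  have "F \<noteq> {}"
    using F by (simp add: facet_of_def)
  have "F \<subseteq> {x. a \<bullet> x = b}"
    using a(5) by blast
  then have aff: "affine hull F \<subseteq> {x. a \<bullet> x = b}"
    by (intro hull_minimal affine_hyperplane)
  have "real CARD('n) powr (- 3 / 2) \<le> dist w y" if y: "y \<in> affine hull F" for y
  proof -
    have "1 \<le> a \<bullet> (y - w)"
      using gap aff y by (auto simp: inner_diff_right)
    also have "\<dots> \<le> norm a * dist w y"
      by (metis norm_cauchy_schwarz dist_norm dist_commute)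
    also have "\<dots> \<le> real CARD('n) powr (3 / 2) * dist w y"
      by (intro mult_right_mono norm_le_of_infnorm_le_card a(2)) simp
    finally show ?thesis
      by (simp add: powr_minus_divide divide_le_eq mult.commute)
  qed
  then show ?thesis
    using \<open>F \<noteq> {}\<close> unfolding infdist_def by (auto intro!: cINF_greatest)
qed

text \<open>\<open>Min\<close> requires a finite nonempty set. A bounded affine set has at most one
  point, so the polytope is not affine; its relative frontier is then nonempty and supplies a facet,
  which misses some point of \<Omega>.\<close>

lemma facet_gap_geI:
  fixes \<Omega> :: "(real ^ 'n) set"
  assumes fin: "finite \<Omega>" and two: "card \<Omega> \<ge> 2"
    and le: "\<And>F w. F facet_of convex hull \<Omega> \<Longrightarrow> w \<in> \<Omega> - F \<Longrightarrow> c \<le> infdist w (affine hull F)"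
  shows "c \<le> facet_gap \<Omega>"
proof -
  let ?P = "convex hull \<Omega>"
  let ?D = "{infdist w (affine hull F) | w F. F facet_of ?P \<and> w \<in> \<Omega> - F}"
  have "?D \<subseteq> (\<lambda>(w, F). infdist w (affine hull F)) ` (\<Omega> \<times> {F. F facet_of ?P})"
    by auto
  moreover have "polytope ?P"
    using fin by (auto simp: polytope_def)
  ultimately have finD: "finite ?D"
    using fin finite_polytope_facets finite_subset by fastforce
  obtain p q where pq: "p \<in> \<Omega>" "q \<in> \<Omega>" "p \<noteq> q"
    using two by (metis card_2_iff' ex_card subsetD)
  have "\<not> affine ?P"
  proof
    assume "affine ?P"
    then have "\<Omega> \<subseteq> {} \<or> (\<exists>a. \<Omega> \<subseteq> {a})"
      using affine_bounded_eq_trivial polytope_imp_bounded[OF \<open>polytope ?P\<close>] hull_subset[of \<Omega> convex]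
      by metis
    then show False
      using pq by auto
  qed
  then obtain F where F: "F facet_of ?P"
    using rel_frontier_of_polyhedron[OF polytope_imp_polyhedron[OF \<open>polytope ?P\<close>]]
      rel_frontier_eq_empty[of ?P] by auto
  then have "F face_of ?P" "F \<noteq> ?P"
    by (auto simp: facet_of_def)
  then have "\<not> ?P \<subseteq> F"
    using face_of_imp_subset by blast
  then have "\<not> \<Omega> \<subseteq> F"
    using face_of_imp_convex[OF \<open>F face_of ?P\<close>] hull_minimal by metis
  then have "?D \<noteq> {}"
    using F by blast
  then show ?thesis
    unfolding facet_gap_def using finD le by (subst Min_ge_iff) auto
qed

section \<open>The relative radius\<close>

text \<open>\<open>GREATEST\<close> requires an attained maximum: admissible radii are bounded
  because the polytope is bounded while its affine hull contains a line, and their supremum is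
  admissible because the polytope is closed.\<close>

lemma rel_radius_geI:
  fixes \<Omega> :: "(real ^ 'n) set"
  assumes fin: "finite \<Omega>" and two: "card \<Omega> \<ge> 2" and z: "z \<in> affine hull \<Omega>"
    and r: "0 \<le> r" "cball z r \<inter> affine hull \<Omega> \<subseteq> convex hull \<Omega>"
  shows "r \<le> rel_radius \<Omega> z"
proof -
  let ?P = "convex hull \<Omega>"
  define S where "S = {r. 0 \<le> r \<and> cball z r \<inter> affine hull \<Omega> \<subseteq> ?P}"
  have "compact ?P"
    using fin by (simp add: finite_imp_compact compact_convex_hull)
  then obtain B where B: "\<And>x. x \<in> ?P \<Longrightarrow> dist z x \<le> B"
    using compact_imp_bounded bounded_any_center[of ?P z] by blast
  obtain p q where pq: "p \<in> \<Omega>" "q \<in> \<Omega>" "p \<noteq> q"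
    using two by (metis card_2_iff' ex_card subsetD)
  have bound: "s \<le> B" if "s \<in> S" for s
  proof -
    \<comment> \<open>Scaled so that the point reached from \<open>z\<close> in direction
      \<open>p - q\<close> has distance exactly \<open>s\<close>.\<close>
    let ?t = "s / norm (p - q)"
    have "z + ?t *\<^sub>R (p - q) \<in> affine hull \<Omega>"
      using pq z hull_inc[of _ \<Omega> affine] by (intro mem_affine_3_minus) auto
    moreover have dist: "dist z (z + ?t *\<^sub>R (p - q)) = s"
      using pq(3) that by (simp add: dist_norm S_def)
    ultimately have "z + ?t *\<^sub>R (p - q) \<in> ?P"
      using that by (auto simp: S_def)
    then show ?thesis
      using B dist by metis
  qed
  have rS: "r \<in> S"
    using r by (simp add: S_def)
  have bdd: "bdd_above S"
    using bound by (rule bdd_aboveI)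
  have "x \<in> ?P" if x: "x \<in> cball z (Sup S)" "x \<in> affine hull \<Omega>" for x
  proof -
    \<comment> \<open>The factors stay below 1, so for \<open>x\<close> other than \<open>z\<close>
      the points \<open>y n\<close> lie strictly inside the supremal radius, hence in an admissible
      ball; they converge to \<open>x\<close>.\<close>
    define c where "c n = 1 - inverse (real (Suc n))" for n
    define y where "y n = z + c n *\<^sub>R (x - z)" for n
    have c: "0 \<le> c n" "c n < 1" for n
      by (auto simp: c_def field_simps)
    have "y n \<in> ?P" for n
    proof (cases "x = z")
      case True
      then show ?thesis
        using r z by (auto simp: y_def)
    next
      case False
      have "dist z (y n) = c n * dist z x"
        using c(1)[of n] by (simp add: y_def dist_norm norm_minus_commute)
      also have "\<dots> < dist z x"
        using False c(2)[of n] by simp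
      also have "\<dots> \<le> Sup S"
        using x by simp
      finally obtain s where s: "s \<in> S" "dist z (y n) < s"
        using less_cSup_iff[of S] rS bdd by blast
      have "y n = (1 - c n) *\<^sub>R z + c n *\<^sub>R x"
        by (simp add: y_def algebra_simps)
      then have "y n \<in> affine hull \<Omega>"
        using z x(2) by (simp add: mem_affine)
      then show ?thesis
        using s by (auto simp: S_def)
    qed
    moreover have "y \<longlonglongrightarrow> z + (1 - 0) *\<^sub>R (x - z)"
      unfolding y_def c_def by (intro tendsto_intros LIMSEQ_inverse_real_of_nat)
    ultimately show ?thesis
      using closed_sequentially[OF compact_imp_closed[OF \<open>compact ?P\<close>], of y] by simp
  qed
  moreover have "0 \<le> Sup S"
    using cSup_upper[OF rS bdd] r(1) by simp
  ultimately have "rel_radius \<Omega> z = Sup S"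
    unfolding rel_radius_def using cSup_upper[OF _ bdd]
    by (intro Greatest_equality) (auto simp: S_def)
  then show ?thesis
    using cSup_upper[OF rS bdd] by simp
qed

text \<open>\<delta> bounds from below the positive slacks at \<open>z\<close> of all integral
  inequalities. A point of the ball outside the polytope would violate one of them, so
  \<open>a\<close> would have to grow by more than \<delta> within the ball, against
  Cauchy-Schwarz.\<close>

lemma totally_unimodular_rel_radius:
  fixes \<omega> :: "'k::finite \<Rightarrow> real ^ 'n"
  assumes tu: "totally_unimodular (\<chi> i j. \<omega> j $ i)"
    and two: "card (range \<omega>) \<ge> 2"
    and z: "z \<in> rel_interior (convex hull (range \<omega>))"
    and \<delta>: "0 \<le> \<delta>" "\<And>a b. a \<in> int_lattice \<Longrightarrow> b \<in> \<int> \<Longrightarrow> a \<bullet> z < b \<Longrightarrow> \<delta> \<le> b - a \<bullet> z"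
  shows "\<delta> * real CARD('n) powr (- 3 / 2) \<le> rel_radius (range \<omega>) z"
proof (rule rel_radius_geI)
  let ?n = "real CARD('n)"
  show "z \<in> affine hull (range \<omega>)"
    using z rel_interior_subset convex_hull_subset_affine_hull by blast
  show "0 \<le> \<delta> * ?n powr (- 3 / 2)"
    using \<delta>(1) by simp
  show "cball z (\<delta> * ?n powr (- 3 / 2)) \<inter> affine hull (range \<omega>) \<subseteq> convex hull (range \<omega>)"
  proof (rule ccontr)
    assume "\<not> ?thesis"
    then obtain x where "x \<in> cball z (\<delta> * ?n powr (- 3 / 2)) \<inter> affine hull (range \<omega>)"
      "x \<notin> convex hull (range \<omega>)"
      by blast
    then have x: "dist z x \<le> \<delta> * ?n powr (- 3 / 2)" "x \<in> affine hull (range \<omega>)"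
      "x \<notin> convex hull (range \<omega>)"
      by simp_all
    obtain a b where a: "a \<in> int_lattice" "infnorm a \<le> ?n" "b \<in> \<int>" "a \<bullet> z < b" "b < a \<bullet> x"
      using totally_unimodular_separation[OF tu x(2,3) z] by metis
    have "\<delta> < a \<bullet> (x - z)"
      using \<delta>(2)[OF a(1,3,4)] a(5) by (simp add: inner_diff_right)
    also have "\<dots> \<le> norm a * dist z x"
      by (metis norm_cauchy_schwarz dist_norm dist_commute)
    also have "\<dots> \<le> ?n powr (3 / 2) * (\<delta> * ?n powr (- 3 / 2))"
      by (intro mult_mono norm_le_of_infnorm_le_card a(2) x(1)) auto
    also have "\<dots> = \<delta>"
      by (simp add: powr_minus_divide)
    finally show False
      by simp
  qed
qed (use two in auto)

section \<open>Encoding length and denominators\<close>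

lemma powr_enc_int_ge: "real_of_int \<bar>m\<bar> \<le> 2 powr real_of_int (enc_int m)"
proof -
  have "real_of_int \<bar>m\<bar> \<le> 2 powr log 2 (real_of_int (\<bar>m\<bar> + 1))"
    by simp
  also have "\<dots> \<le> 2 powr real_of_int (enc_int m)"
    unfolding enc_int_def by (intro powr_mono) (simp_all, linarith)
  finally show ?thesis .
qed

lemma enc_int_nonneg: "0 \<le> enc_int m"
proof -
  have "0 \<le> log 2 (real_of_int (\<bar>m\<bar> + 1))"
    by (intro zero_le_log_cancel_iff[THEN iffD2]) auto
  then show ?thesis
    unfolding enc_int_def by linarith
qed

text \<open>The product \<open>D\<close> of the denominators makes the slack a positive integer.
  Each denominator is at most 2 to its own encoding length; the numerators and the summand
  \<open>CARD('n)\<close> only enlarge the exponent.\<close>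

lemma rational_point_gap:
  fixes \<theta> :: "rat ^ 'n"
  assumes a: "a \<in> int_lattice" and b: "b \<in> \<int>" and lt: "a \<bullet> real_vec \<theta> < b"
  shows "2 powi (- enc_vec \<theta>) \<le> b - a \<bullet> real_vec \<theta>"
proof -
  define s where "s j = snd (quotient_of (\<theta> $ j))" for j
  define D where "D = (\<Prod>j\<in>UNIV. real_of_int (s j))"
  have s: "0 < s j" for j
    unfolding s_def by (rule quotient_of_denom_pos')
  have cleared: "of_rat (\<theta> $ j) * real_of_int (s j) \<in> \<int>" for j
  proof -
    have "\<theta> $ j = of_int (fst (quotient_of (\<theta> $ j))) / of_int (s j)"
      unfolding s_def by (intro quotient_of_div) simp
    then have "of_rat (\<theta> $ j) = real_of_int (fst (quotient_of (\<theta> $ j))) / real_of_int (s j)"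
      by (metis of_rat_divide of_rat_of_int_eq)
    then show ?thesis
      using s[of j] by simp
  qed
  have "D * real_vec \<theta> $ j \<in> \<int>" for j
  proof -
    have "D * real_vec \<theta> $ j = (of_rat (\<theta> $ j) * real_of_int (s j)) * (\<Prod>i\<in>UNIV - {j}. real_of_int (s i))"
      unfolding D_def real_vec_def by (subst prod.remove[of _ j]) simp_all
    then show ?thesis
      by (simp only:) (intro Ints_mult Ints_prod cleared Ints_of_int)
  qed
  then have "D *\<^sub>R real_vec \<theta> \<in> int_lattice"
    by (simp add: int_lattice_def)
  moreover have "D \<in> \<int>"
    by (simp add: D_def Ints_prod)
  ultimately have "b * D - a \<bullet> (D *\<^sub>R real_vec \<theta>) \<in> \<int>"
    using a b by (intro Ints_diff Ints_mult inner_int_lattice)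
  moreover have "b * D - a \<bullet> (D *\<^sub>R real_vec \<theta>) = (b - a \<bullet> real_vec \<theta>) * D"
    by (simp add: algebra_simps)
  moreover have D: "0 < D"
    using s by (simp add: D_def prod_pos)
  ultimately have "1 \<le> (b - a \<bullet> real_vec \<theta>) * D"
    using lt by (intro Ints_pos_ge_1) auto
  moreover have "D \<le> 2 powr real_of_int (enc_vec \<theta>)"
  proof -
    have "D \<le> (\<Prod>j\<in>UNIV. 2 powr real_of_int (enc_rat (\<theta> $ j)))"
      unfolding D_def
    proof (rule prod_mono)
      fix j
      have "real_of_int (s j) \<le> 2 powr real_of_int (enc_int (s j))"
        using powr_enc_int_ge[of "s j"] s[of j] by simp
      also have "\<dots> \<le> 2 powr real_of_int (enc_rat (\<theta> $ j))"
        using enc_int_nonneg by (simp add: enc_rat_def s_def)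
      finally show "0 \<le> real_of_int (s j) \<and> real_of_int (s j) \<le> 2 powr real_of_int (enc_rat (\<theta> $ j))"
        using s[of j] by simp
    qed
    also have "\<dots> = 2 powr real_of_int (\<Sum>j\<in>UNIV. enc_rat (\<theta> $ j))"
      by (simp add: powr_sum)
    also have "\<dots> \<le> 2 powr real_of_int (enc_vec \<theta>)"
      by (simp add: enc_vec_def)
    finally show ?thesis .
  qed
  ultimately have "1 \<le> (b - a \<bullet> real_vec \<theta>) * 2 powr real_of_int (enc_vec \<theta>)"
    using lt by (meson diff_gt_0_iff_gt less_imp_le mult_left_mono order_trans)
  then have "2 powr real_of_int (- enc_vec \<theta>) \<le> b - a \<bullet> real_vec \<theta>"
    by (simp add: powr_minus_divide divide_le_eq)
  then show ?thesis
    by (subst (asm) powr_real_of_int') auto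
qed

section \<open>Unary facet complexity and the final bounds\<close>

lemma totally_unimodular_ufc:
  fixes \<omega> :: "'k::finite \<Rightarrow> real ^ 'n"
  assumes tu: "totally_unimodular (\<chi> i j. \<omega> j $ i)"
  shows "ufc (convex hull (range \<omega>)) \<le> CARD('n)"
proof -
  let ?P = "convex hull (range \<omega>)"
  \<comment> \<open>All valid inequalities with admissible normals; by separation, each point of the
    affine hull outside the polytope violates one of them.\<close>
  define H where "H = {(a :: real ^ 'n, b). a \<in> int_lattice \<and> infnorm a \<le> real CARD('n) \<and>
    ?P \<subseteq> {p. p \<bullet> a \<le> b}}"
  obtain z where z: "z \<in> rel_interior ?P"
    using rel_interior_eq_empty[of ?P] by auto
  have "x \<in> ?P" if x: "x \<in> affine hull ?P" "x \<in> (\<Inter>(a, b) \<in> H. {p. p \<bullet> a \<le> b})" for x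
  proof (rule ccontr)
    assume "x \<notin> ?P"
    then obtain a b where a: "a \<in> int_lattice" "infnorm a \<le> real CARD('n)"
      "?P \<subseteq> {x. a \<bullet> x \<le> b}" "b < a \<bullet> x"
      using totally_unimodular_separation[OF tu _ _ z, of x] x(1) by (metis affine_hull_convex_hull)
    then have "(a, b) \<in> H"
      by (simp add: H_def inner_commute)
    then show False
      using x(2) a(4) by (force simp: inner_commute)
  qed
  then have "?P = affine hull ?P \<inter> (\<Inter>(a, b) \<in> H. {p. p \<bullet> a \<le> b})"
    using hull_subset[of ?P affine] by (auto simp: H_def)
  then show ?thesis
    unfolding ufc_def by (intro Least_le exI[of _ H]) (auto simp: H_def)
qed

theorem theorem4p5:
  fixes \<omega> :: "'k::finite \<Rightarrow> real ^ 'n" and \<Omega> :: "(real ^ 'n) set"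
  assumes \<Omega>: "\<Omega> = range \<omega>"
    and integral: "\<Omega> \<subseteq> int_lattice"
    and two_points: "card \<Omega> \<ge> 2"
    and tu: "totally_unimodular (\<chi> i j. \<omega> j $ i)"
  shows "ufc (convex hull \<Omega>) \<le> CARD('n) \<and>
    facet_gap \<Omega> \<ge> real CARD('n) powr (- 3 / 2) \<and>
    (\<forall>\<theta> :: rat ^ 'n. real_vec \<theta> \<in> rel_interior (convex hull \<Omega>) \<longrightarrow>
       rel_radius \<Omega> (real_vec \<theta>) \<ge> 2 powi (- enc_vec \<theta>) * real CARD('n) powr (- 3 / 2)) \<and>
    (0 \<in> rel_interior (convex hull \<Omega>) \<longrightarrow>
       rel_radius \<Omega> 0 \<ge> real CARD('n) powr (- 3 / 2))"
proof (intro conjI allI impI)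
  show "ufc (convex hull \<Omega>) \<le> CARD('n)"
    unfolding \<Omega> by (rule totally_unimodular_ufc[OF tu])
  show "facet_gap \<Omega> \<ge> real CARD('n) powr (- 3 / 2)"
  proof (rule facet_gap_geI[OF _ two_points])
    fix F w
    assume "F facet_of convex hull \<Omega>" "w \<in> \<Omega> - F"
    then show "real CARD('n) powr (- 3 / 2) \<le> infdist w (affine hull F)"
      using totally_unimodular_infdist_facet[OF tu] integral unfolding \<Omega> by blast
  qed (simp add: \<Omega>)
next
  fix \<theta> :: "rat ^ 'n"
  assume "real_vec \<theta> \<in> rel_interior (convex hull \<Omega>)"
  then show "rel_radius \<Omega> (real_vec \<theta>) \<ge> 2 powi (- enc_vec \<theta>) * real CARD('n) powr (- 3 / 2)"
    unfolding \<Omega>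
    by (rule totally_unimodular_rel_radius[OF tu two_points[unfolded \<Omega>] _ _ rational_point_gap]) simp
next
  assume "0 \<in> rel_interior (convex hull \<Omega>)"
  \<comment> \<open>Here \<delta> is 1, since the slack at the origin is the integer
    \<open>b\<close> itself.\<close>
  then have "1 * real CARD('n) powr (- 3 / 2) \<le> rel_radius \<Omega> 0"
    unfolding \<Omega>
    by (rule totally_unimodular_rel_radius[OF tu two_points[unfolded \<Omega>]]) (simp_all add: Ints_pos_ge_1)
  then show "rel_radius \<Omega> 0 \<ge> real CARD('n) powr (- 3 / 2)"
    by simp
qed

end
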